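(* Penalized PLS equals ordinary PLS with the canonical inner product on $\mathbb{R}^p$ replaced by the inner product $\langle x,z\rangle_M=x^TMz$, where $M=(I_p+P)^{-1}$. That is, for every $m\ge1$, the components $t_1,\dots,t_m$ computed by penalized PLS with penalty matrix $P$ coincide with the components computed by ordinary PLS with respect to $\langle\cdot,\cdot\rangle_M$ from the same data $X,y$, and hence so do the fitted responses $\mathcal{P}_{(t_1,\dots,t_m)}y$.
   Context: Let $X\in\mathbb{R}^{n\times p}$ and $y\in\mathbb{R}^n$ be centered, and let $P\in\mathbb{R}^{p\times p}$ be a symmetric matrix such that $I_p+P$ is positive definite. For a matrix $V$, $\mathcal{P}_V=V(V^TV)^{-}V^T$ denotes the orthogonal projection onto the column space of $V$ (in $\mathbb{R}^n$ with the usual inner product). Penalized PLS: set $X_1=X$ and for $i=1,2,\dots$ let $w_i=MX_i^Ty$, $t_i=X_iw_i$, $X_{i+1}=X_i-\mathcal{P}_{t_i}X_i$. Ordinary PLS (NIPALS algorithm) with respect to an inner product $\langle\cdot,\cdot\rangle$ on $\mathbb{R}^p$: set $X_1=X$ and for $i=1,2,\dots$ let $w_i=X_i^Ty$, let the component $t_i\in\mathbb{R}^n$ be the vector whose $k$th entry is $\langle x^{(i)}_k,w_i\rangle$, where $(x^{(i)}_k)^T$ is the $k$th row of $X_i$, and let $X_{i+1}=X_i-\mathcal{P}_{t_i}X_i$. For the canonical inner product, $t_i=X_iw_i$, and this is the usual PLS algorithm. *)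

theory Defs
  imports
    Complex_Main
    "Jordan_Normal_Form.Gauss_Jordan_Elimination"
    "Jordan_Normal_Form.Determinant"
begin

definition centered_vec :: "real vec \<Rightarrow> bool" where
  "centered_vec v \<longleftrightarrow> (\<Sum>i<dim_vec v. v $ i) = 0"

definition centered_mat :: "real mat \<Rightarrow> bool" where
  "centered_mat X \<longleftrightarrow> (\<forall>j<dim_col X. centered_vec (col X j))"

definition pos_def_mat :: "real mat \<Rightarrow> bool" where
  "pos_def_mat A \<longleftrightarrow> square_mat A \<and>
     (\<forall>v\<in>carrier_vec (dim_row A). v \<noteq> 0\<^sub>v (dim_row A) \<longrightarrow> v \<bullet> (A *\<^sub>v v) > 0)"

definition is_inner_product :: "nat \<Rightarrow> (real vec \<Rightarrow> real vec \<Rightarrow> real) \<Rightarrow> bool" where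
  "is_inner_product p ip \<longleftrightarrow>
     (\<forall>x\<in>carrier_vec p. \<forall>z\<in>carrier_vec p. ip x z = ip z x) \<and>
     (\<forall>x\<in>carrier_vec p. \<forall>x'\<in>carrier_vec p. \<forall>z\<in>carrier_vec p. ip (x + x') z = ip x z + ip x' z) \<and>
     (\<forall>c. \<forall>x\<in>carrier_vec p. \<forall>z\<in>carrier_vec p. ip (c \<cdot>\<^sub>v x) z = c * ip x z) \<and>
     (\<forall>x\<in>carrier_vec p. x \<noteq> 0\<^sub>v p \<longrightarrow> ip x x > 0)"


section \<open>Projections onto column spaces\<close>

definition is_ginv :: "real mat \<Rightarrow> real mat \<Rightarrow> bool" where
  "is_ginv A G \<longleftrightarrow> G \<in> carrier_mat (dim_col A) (dim_row A) \<and> A * G * A = A"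

definition ginv :: "real mat \<Rightarrow> real mat" where
  "ginv A = (SOME G. is_ginv A G)"

text \<open>The choice of generalized inverse in \<open>proj\<close> is immaterial, and \<open>proj V\<close> is the
  orthogonal projection onto the column space of \<open>V\<close>; see \<open>proj_orthogonal\<close> and \<open>proj_ginv\<close>
  below.\<close>

definition proj :: "real mat \<Rightarrow> real mat" where
  "proj V = V * ginv (V\<^sup>T * V) * V\<^sup>T"

lemma ex_ginv_pivot:
  assumes R: "R \<in> carrier_mat nr nc" and piv: "pivot_fun R f nc"
  shows "\<exists>G \<in> carrier_mat nc nr. R * G * R = (R :: real mat)"
proof -
  have d: "dim_row R = nr" using R by auto
  note p = pivot_funD[OF d piv]
  define G :: "real mat" where "G = mat nc nr (\<lambda>(j,i). if f i = j then 1 else 0)"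
  have G: "G \<in> carrier_mat nc nr" by (simp add: G_def)
  have RG: "(R * G) $$ (i,k) = (if i = k \<and> f k < nc then 1 else 0)"
    if "i < nr" "k < nr" for i k
  proof -
    have "(R * G) $$ (i,k) = (\<Sum>j = 0..<nc. R $$ (i,j) * (if f k = j then 1 else 0))"
      using that R by (auto simp: G_def scalar_prod_def)
    also have "\<dots> = (if f k < nc then R $$ (i, f k) else 0)"
      by (simp add: if_distrib sum.delta' cong: if_cong)
    also have "\<dots> = (if i = k \<and> f k < nc then 1 else 0)"
      using p(4)[of k] p(5)[of k i] that by auto
    finally show ?thesis .
  qed
  have "R * G * R = R"
  proof (rule eq_matI)
    fix i l assume "i < dim_row R" "l < dim_col R"
    hence il: "i < nr" "l < nc" using R by auto
    have "(R * G * R) $$ (i,l) = (\<Sum>k = 0..<nr. (R * G) $$ (i,k) * R $$ (k,l))"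
    proof -
      define S where "S = R * G"
      have "S \<in> carrier_mat nr nr" using R G by (simp add: S_def)
      hence "(S * R) $$ (i,l) = (\<Sum>k = 0..<nr. S $$ (i,k) * R $$ (k,l))"
        using il R by (auto simp: scalar_prod_def)
      thus ?thesis by (simp only: S_def)
    qed
    also have "\<dots> = (\<Sum>k = 0..<nr. if k = i then (if f i < nc then R $$ (i,l) else 0) else 0)"
      by (rule sum.cong) (use il RG in auto)
    also have "\<dots> = (if f i < nc then R $$ (i,l) else 0)"
      using il by simp
    also have "\<dots> = R $$ (i,l)"
      using p(1)[of i] p(2)[of i l] il by auto
    finally show "(R * G * R) $$ (i,l) = R $$ (i,l)" .
  qed (use R G in auto)
  with G show ?thesis by blast
qed

lemma ex_is_ginv: "\<exists>G. is_ginv A G"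
proof -
  define nr nc where "nr = dim_row A" and "nc = dim_col A"
  have A: "A \<in> carrier_mat nr nc" by (simp add: nr_def nc_def)
  obtain C where C: "gauss_jordan_single A = C" by blast
  note gj = gauss_jordan_single[OF A C]
  from gj(4) obtain P Q where PQ: "C = P * A" "P \<in> carrier_mat nr nr" "Q \<in> carrier_mat nr nr"
    "Q * P = 1\<^sub>m nr" by blast
  from gj(2,3) obtain f where "pivot_fun C f nc" unfolding row_echelon_form_def by auto
  from ex_ginv_pivot[OF gj(2) this] obtain G where
    G: "G \<in> carrier_mat nc nr" "C * G * C = C" by blast
  have QC: "Q * C = A"
    unfolding PQ(1) using PQ(2-4) A by (simp flip: assoc_mult_mat[of Q nr nr P nr A nc])
  have "A * (G * P) * A = A * ((G * P) * A)"
    using A G PQ by (intro assoc_mult_mat[of A nr nc "G * P" nr A nc]) auto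
  also have "(G * P) * A = G * (P * A)"
    using A G PQ by (intro assoc_mult_mat[of G nc nr P nr A nc]) auto
  also have "A * (G * (P * A)) = A * G * (P * A)"
    using A G PQ by (intro assoc_mult_mat[of A nr nc G nr "P * A" nc, symmetric]) auto
  also have "\<dots> = Q * C * G * C" using QC by (simp flip: PQ(1))
  also have "\<dots> = Q * (C * G * C)"
    using gj(2) G(1) PQ(3) by (simp add: assoc_mult_mat[of Q nr nr C nc G nr]
      assoc_mult_mat[of Q nr nr "C * G" nr C nc])
  also have "\<dots> = A" by (simp add: G QC)
  finally have "is_ginv A (G * P)"
    unfolding is_ginv_def using A G PQ by auto
  thus ?thesis by blast
qed

lemma is_ginv_ginv: "is_ginv A (ginv A)"
  unfolding ginv_def using ex_is_ginv by (rule someI_ex)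

lemma gram_zero:
  assumes D: "D \<in> carrier_mat n m" and z: "D\<^sup>T * D = 0\<^sub>m m m"
  shows "D = (0\<^sub>m n m :: real mat)"
proof (rule eq_matI)
  fix i j assume "i < dim_row (0\<^sub>m n m :: real mat)" "j < dim_col (0\<^sub>m n m :: real mat)"
  hence ij: "i < n" "j < m" by auto
  have "(\<Sum>k = 0..<n. D $$ (k,j) * D $$ (k,j)) = (D\<^sup>T * D) $$ (j,j)"
    using D ij by (simp add: scalar_prod_def)
  also have "\<dots> = 0" using z ij by simp
  finally have "D $$ (i,j) * D $$ (i,j) = 0"
    using ij by (subst (asm) sum_nonneg_eq_0_iff) auto
  thus "D $$ (i,j) = 0\<^sub>m n m $$ (i,j)" using ij by simp
qed (use D in auto)

lemma gram_ginv:
  assumes V: "V \<in> carrier_mat n m" and g: "is_ginv (V\<^sup>T * V) G"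
  shows "V * G * (V\<^sup>T * V) = V"
proof -
  let ?A = "V\<^sup>T * V"
  have A: "?A \<in> carrier_mat m m" using V by auto
  have G: "G \<in> carrier_mat m m" and AGA: "?A * G * ?A = ?A"
    using g V by (auto simp: is_ginv_def)
  define H where "H = G * ?A - 1\<^sub>m m"
  have H: "H \<in> carrier_mat m m" using G A by (auto simp: H_def)
  have VH: "V * H = V * G * ?A - V"
    unfolding H_def using V G A
      mult_minus_distrib_mat[of V n m "G * ?A" m "1\<^sub>m m"] assoc_mult_mat[of V n m G m ?A m]
    by simp
  have AH: "?A * H = 0\<^sub>m m m"
    unfolding H_def using G A AGA
      mult_minus_distrib_mat[of ?A m m "G * ?A" m "1\<^sub>m m"] assoc_mult_mat[of ?A m m G m ?A m]
      right_mult_one_mat[OF A] minus_r_inv_mat[OF A]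
    by (simp del: assoc_mult_mat)
  have "(V * H)\<^sup>T * (V * H) = H\<^sup>T * (?A * H)"
    using V H by (simp add: transpose_mult[of V n m H m] assoc_mult_mat[of "H\<^sup>T" m m "V\<^sup>T" n "V * H" m]
      assoc_mult_mat[of "V\<^sup>T" m n V m H m])
  also have "\<dots> = 0\<^sub>m m m" using H AH by simp
  finally have z: "V * H = 0\<^sub>m n m" using gram_zero[of "V * H" n m] V H by simp
  show ?thesis
  proof (rule eq_matI)
    fix i j assume ij: "i < dim_row V" "j < dim_col V"
    have "(V * G * ?A - V) $$ (i,j) = 0" using z VH ij V by simp
    thus "(V * G * ?A) $$ (i,j) = V $$ (i,j)" using ij V by simp
  qed (use V in auto)
qed

lemma gram_ginv':
  assumes V: "V \<in> carrier_mat n m" and g: "is_ginv (V\<^sup>T * V) G"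
  shows "V\<^sup>T * (V * G * V\<^sup>T) = V\<^sup>T"
proof -
  define A where "A = V\<^sup>T * V"
  have A: "A \<in> carrier_mat m m" using V by (auto simp: A_def)
  have At: "A\<^sup>T = A" using V by (simp add: A_def transpose_mult[of "V\<^sup>T" m n V m])
  have G: "G \<in> carrier_mat m m" and AGA: "A * G * A = A"
    using g V by (auto simp: is_ginv_def A_def)
  have "(A * G * A)\<^sup>T = A * G\<^sup>T * A"
    using A G by (simp add: transpose_mult[of "A * G" m m A m] transpose_mult[of A m m G m] At
      assoc_mult_mat[of A m m "G\<^sup>T" m A m] del: assoc_mult_mat)
  hence "is_ginv A G\<^sup>T" using AGA At A G V by (simp add: is_ginv_def)
  from gram_ginv[OF V this[unfolded A_def], folded A_def] have "(V * G\<^sup>T * A)\<^sup>T = V\<^sup>T" by simp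
  moreover have "(V * G\<^sup>T * A)\<^sup>T = A * (G * V\<^sup>T)"
    using V A G by (simp add: transpose_mult[of "V * G\<^sup>T" n m A m]
      transpose_mult[of V n m "G\<^sup>T" m] At del: assoc_mult_mat)
  moreover have "A * (G * V\<^sup>T) = V\<^sup>T * (V * G * V\<^sup>T)"
    using V G by (simp add: A_def assoc_mult_mat[of "V\<^sup>T" m n V m "G * V\<^sup>T" n]
      assoc_mult_mat[of V n m G m "V\<^sup>T" n])
  ultimately show ?thesis by simp
qed

lemma proj_orthogonal:
  assumes V: "V \<in> carrier_mat n m" and v: "v \<in> carrier_vec n"
  shows "\<exists>c\<in>carrier_vec m. proj V *\<^sub>v v = V *\<^sub>v c"
    and "V\<^sup>T *\<^sub>v (v - proj V *\<^sub>v v) = 0\<^sub>v m"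
proof -
  let ?G = "ginv (V\<^sup>T * V)"
  have g: "is_ginv (V\<^sup>T * V) ?G" by (rule is_ginv_ginv)
  have G: "?G \<in> carrier_mat m m" using g V by (auto simp: is_ginv_def)
  have P: "proj V \<in> carrier_mat n n" using V G by (simp add: proj_def)
  have "proj V *\<^sub>v v = V *\<^sub>v (?G *\<^sub>v (V\<^sup>T *\<^sub>v v))"
    unfolding proj_def using V G v
    by (simp add: assoc_mult_mat_vec[of "V * ?G" n m "V\<^sup>T" n v]
      assoc_mult_mat_vec[of V n m ?G m "V\<^sup>T *\<^sub>v v"] del: assoc_mult_mat)
  thus "\<exists>c\<in>carrier_vec m. proj V *\<^sub>v v = V *\<^sub>v c" using V G v by auto
  have "V\<^sup>T * proj V = V\<^sup>T" unfolding proj_def by (rule gram_ginv'[OF V g])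
  hence "V\<^sup>T *\<^sub>v (proj V *\<^sub>v v) = V\<^sup>T *\<^sub>v v"
    using V P v by (simp flip: assoc_mult_mat_vec[of "V\<^sup>T" m n "proj V" n v])
  thus "V\<^sup>T *\<^sub>v (v - proj V *\<^sub>v v) = 0\<^sub>v m"
    using V P v by (simp add: mult_minus_distrib_mat_vec[of "V\<^sup>T" m n v])
qed

lemma proj_ginv:
  assumes V: "V \<in> carrier_mat n m" and g: "is_ginv (V\<^sup>T * V) G"
  shows "proj V = V * G * V\<^sup>T"
proof -
  let ?G = "ginv (V\<^sup>T * V)"
  have G: "G \<in> carrier_mat m m" using g V by (auto simp: is_ginv_def)
  have G': "?G \<in> carrier_mat m m" using is_ginv_ginv[of "V\<^sup>T * V"] V by (auto simp: is_ginv_def)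
  have "V * ?G * V\<^sup>T = V * ?G * (V\<^sup>T * (V * G * V\<^sup>T))" by (simp add: gram_ginv'[OF V g])
  also have "\<dots> = V * ?G * (V\<^sup>T * V) * (G * V\<^sup>T)"
    using V G G' by (simp add: assoc_mult_mat[of "V * ?G" n m "V\<^sup>T * V" m "G * V\<^sup>T" n]
      assoc_mult_mat[of "V\<^sup>T" m n V m "G * V\<^sup>T" n] assoc_mult_mat[of V n m G m "V\<^sup>T" n])
  also have "\<dots> = V * (G * V\<^sup>T)" by (simp add: gram_ginv[OF V is_ginv_ginv])
  also have "\<dots> = V * G * V\<^sup>T" using V G by (simp add: assoc_mult_mat[of V n m G m "V\<^sup>T" n])
  finally show ?thesis by (simp add: proj_def)
qed


section \<open>Ordinary and penalized PLS\<close>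

definition deflate :: "real vec \<Rightarrow> real mat \<Rightarrow> real mat" where
  "deflate t Xi = Xi - proj (mat_of_cols (dim_row Xi) [t]) * Xi"

text \<open>All sequences are indexed from \<open>0\<close>: index \<open>i\<close> stands for \<open>X\<^bsub>i+1\<^esub>\<close>, \<open>t\<^bsub>i+1\<^esub>\<close>.\<close>

definition pls_component ::
  "(real vec \<Rightarrow> real vec \<Rightarrow> real) \<Rightarrow> real vec \<Rightarrow> real mat \<Rightarrow> real vec" where
  "pls_component ip y Xi =
     (let w = Xi\<^sup>T *\<^sub>v y in vec (dim_row Xi) (\<lambda>k. ip (row Xi k) w))"

primrec pls_X ::
  "(real vec \<Rightarrow> real vec \<Rightarrow> real) \<Rightarrow> real mat \<Rightarrow> real vec \<Rightarrow> nat \<Rightarrow> real mat" where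
  "pls_X ip X y 0 = X"
| "pls_X ip X y (Suc i) = deflate (pls_component ip y (pls_X ip X y i)) (pls_X ip X y i)"

definition pls_t ::
  "(real vec \<Rightarrow> real vec \<Rightarrow> real) \<Rightarrow> real mat \<Rightarrow> real vec \<Rightarrow> nat \<Rightarrow> real vec" where
  "pls_t ip X y i = pls_component ip y (pls_X ip X y i)"

text \<open>If \<open>I + P\<close> is singular then \<open>mat_inverse\<close> is \<open>None\<close>; this is excluded when \<open>I + P\<close> is
  positive definite.\<close>

definition pen_M :: "real mat \<Rightarrow> real mat" where
  "pen_M P = the (mat_inverse (1\<^sub>m (dim_row P) + P))"

lemma pen_M_inverse:
  assumes P: "P \<in> carrier_mat p p" and pd: "pos_def_mat (1\<^sub>m p + P)"
  shows "pen_M P \<in> carrier_mat p p"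
    and "(1\<^sub>m p + P) * pen_M P = 1\<^sub>m p"
    and "pen_M P * (1\<^sub>m p + P) = 1\<^sub>m p"
proof -
  let ?A = "1\<^sub>m p + P"
  have A: "?A \<in> carrier_mat p p" using P by simp
  have "det ?A \<noteq> 0"
  proof
    assume "det ?A = 0"
    then obtain v where v: "v \<in> carrier_vec p" "v \<noteq> 0\<^sub>v p" "?A *\<^sub>v v = 0\<^sub>v p"
      using det_0_iff_vec_prod_zero[OF A] by blast
    hence "v \<bullet> (?A *\<^sub>v v) > 0" using pd P by (auto simp: pos_def_mat_def)
    thus False using v by simp
  qed
  hence "?A \<in> Units (ring_mat TYPE(real) p ())" by (rule det_non_zero_imp_unit[OF A])
  then obtain B where B: "mat_inverse ?A = Some B"
    using mat_inverse(1)[OF A, of "()"] by (cases "mat_inverse ?A") auto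
  have "pen_M P = B" using B P by (simp add: pen_M_def)
  with mat_inverse(2)[OF A B]
  show "pen_M P \<in> carrier_mat p p" "?A * pen_M P = 1\<^sub>m p" "pen_M P * ?A = 1\<^sub>m p" by auto
qed

definition pen_pls_component :: "real mat \<Rightarrow> real vec \<Rightarrow> real mat \<Rightarrow> real vec" where
  "pen_pls_component P y Xi = (let w = pen_M P *\<^sub>v (Xi\<^sup>T *\<^sub>v y) in Xi *\<^sub>v w)"

primrec pen_pls_X :: "real mat \<Rightarrow> real mat \<Rightarrow> real vec \<Rightarrow> nat \<Rightarrow> real mat" where
  "pen_pls_X P X y 0 = X"
| "pen_pls_X P X y (Suc i) =
     deflate (pen_pls_component P y (pen_pls_X P X y i)) (pen_pls_X P X y i)"

definition pen_pls_t :: "real mat \<Rightarrow> real mat \<Rightarrow> real vec \<Rightarrow> nat \<Rightarrow> real vec" where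
  "pen_pls_t P X y i = pen_pls_component P y (pen_pls_X P X y i)"

definition fitted :: "real vec \<Rightarrow> real vec list \<Rightarrow> real vec" where
  "fitted y ts = proj (mat_of_cols (dim_vec y) ts) *\<^sub>v y"

definition ip_mat :: "real mat \<Rightarrow> real vec \<Rightarrow> real vec \<Rightarrow> real" where
  "ip_mat M x z = x \<bullet> (M *\<^sub>v z)"

end

theory Submission
  imports Defs
begin

text \<open>The \<open>k\<close>th entry of \<open>X_i M X_i^T y\<close> is the
  \<open>M\<close>-inner product of the \<open>k\<close>th row of \<open>X_i\<close> with
  \<open>X_i^T y\<close>. So \<open>M\<close> may be read as part of the weight vector or as part of
  the inner product: both algorithms apply one and the same map from \<open>X_i\<close> to
  \<open>t_i\<close> (\<open>pen_pls_component_eq_pls_component\<close>). Deflation sees only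
  \<open>t_i\<close> and \<open>X_i\<close>, so by induction all iterates agree. It remains that
  \<open>M\<close> defines an inner product; the substitution \<open>x = A u\<close> carries
  symmetry and positivity from \<open>A = I + P\<close> to its inverse.\<close>

lemma is_inner_product_inverse:
  assumes A: "A \<in> carrier_mat p p" and sym: "A\<^sup>T = A" and pd: "pos_def_mat A"
    and M: "M \<in> carrier_mat p p" and AM: "A * M = 1\<^sub>m p"
  shows "is_inner_product p (ip_mat M)"
proof -
  have AMv: "A *\<^sub>v (M *\<^sub>v x) = x" if "x \<in> carrier_vec p" for x
    using assoc_mult_mat_vec[OF A M that] AM that by simp
  have A_adj: "(A *\<^sub>v u) \<bullet> v = u \<bullet> (A *\<^sub>v v)"
    if "u \<in> carrier_vec p" "v \<in> carrier_vec p" for u v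
    using transpose_vec_mult_scalar[OF A that(2,1)] A that
    by (simp add: sym comm_scalar_prod[of _ p])
  have M_sym: "ip_mat M x z = ip_mat M z x"
    if x: "x \<in> carrier_vec p" and z: "z \<in> carrier_vec p" for x z
  proof -
    \<comment> \<open>Insert \<open>A M = I\<close> in front of \<open>x\<close>, then move the
      symmetric \<open>A\<close> to the other factor, where it cancels \<open>M\<close>.\<close>
    have "x \<bullet> (M *\<^sub>v z) = (A *\<^sub>v (M *\<^sub>v x)) \<bullet> (M *\<^sub>v z)"
      by (simp add: AMv x)
    also have "\<dots> = (M *\<^sub>v x) \<bullet> z"
      using A_adj[of "M *\<^sub>v x" "M *\<^sub>v z"] M x z by (simp add: AMv)
    also have "\<dots> = z \<bullet> (M *\<^sub>v x)"
      using M x z by (intro comm_scalar_prod[of _ p]) auto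
    finally show ?thesis by (simp add: ip_mat_def)
  qed
  have M_pos: "ip_mat M x x > 0" if x: "x \<in> carrier_vec p" and nz: "x \<noteq> 0\<^sub>v p" for x
  proof -
    let ?u = "M *\<^sub>v x"
    have u: "?u \<in> carrier_vec p" using M x by simp
    have "A *\<^sub>v 0\<^sub>v p = 0\<^sub>v p" using A by (intro eq_vecI) auto
    \<comment> \<open>\<open>M\<close> is injective, since \<open>x\<close> is recovered as
      \<open>A (M x)\<close>.\<close>
    hence "?u \<noteq> 0\<^sub>v p" using AMv[OF x] nz by auto
    hence "0 < ?u \<bullet> (A *\<^sub>v ?u)" using pd A u by (auto simp: pos_def_mat_def)
    also have "\<dots> = ip_mat M x x"
      using u x by (simp add: AMv ip_mat_def comm_scalar_prod[of _ p])
    finally show ?thesis .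
  qed
  have M_add: "ip_mat M (x + x') z = ip_mat M x z + ip_mat M x' z"
    if "x \<in> carrier_vec p" "x' \<in> carrier_vec p" "z \<in> carrier_vec p" for x x' z
    unfolding ip_mat_def using that M by (intro add_scalar_prod_distrib[of _ p]) auto
  have M_smult: "ip_mat M (c \<cdot>\<^sub>v x) z = c * ip_mat M x z"
    if "x \<in> carrier_vec p" "z \<in> carrier_vec p" for c x z
    unfolding ip_mat_def using that M by (intro smult_scalar_prod_distrib[of _ p]) auto
  show ?thesis
    unfolding is_inner_product_def by (intro conjI ballI allI impI M_sym M_add M_smult M_pos)
qed

text \<open>A matrix-vector product is by definition the vector of scalar products with the rows, so
  both sides unfold to the same \<open>vec\<close>.\<close>

lemma pen_pls_component_eq_pls_component:
  "pen_pls_component P y Xi = pls_component (ip_mat (pen_M P)) y Xi"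
  by (simp add: pen_pls_component_def pls_component_def ip_mat_def mult_mat_vec_def Let_def)

text \<open>Both recursions start at \<open>X\<close> and share \<open>deflate\<close>, so equal
  component maps suffice.\<close>

lemma pen_pls_X_eq_pls_X: "pen_pls_X P X y i = pls_X (ip_mat (pen_M P)) X y i"
  by (induction i) (simp_all add: pen_pls_component_eq_pls_component)

lemma pen_pls_t_eq_pls_t: "pen_pls_t P X y = pls_t (ip_mat (pen_M P)) X y"
  by (rule ext)
    (simp add: pen_pls_t_def pls_t_def pen_pls_X_eq_pls_X pen_pls_component_eq_pls_component)

theorem mainTheorem2:
  fixes n p :: nat and X P :: "real mat" and y :: "real vec"
  assumes "X \<in> carrier_mat n p" and "y \<in> carrier_vec n"
    and "centered_mat X" and "centered_vec y"
    and "P \<in> carrier_mat p p" and "P\<^sup>T = P"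
    and "pos_def_mat (1\<^sub>m p + P)"
  shows "is_inner_product p (ip_mat (pen_M P)) \<and>
    (\<forall>m\<ge>1.
      map (pen_pls_t P X y) [0..<m] = map (pls_t (ip_mat (pen_M P)) X y) [0..<m] \<and>
      fitted y (map (pen_pls_t P X y) [0..<m]) =
        fitted y (map (pls_t (ip_mat (pen_M P)) X y) [0..<m]))"
proof -
  note M = pen_M_inverse[OF assms(5,7)]
  have carrier: "1\<^sub>m p + P \<in> carrier_mat p p" using assms(5) by simp
  have "(1\<^sub>m p + P)\<^sup>T = 1\<^sub>m p + P"
    using transpose_add[OF one_carrier_mat assms(5)] by (simp add: assms(6))
  from is_inner_product_inverse[OF carrier this assms(7) M(1,2)]
  \<comment> \<open>The component sequences are equal as functions, so the lists and the fitted
    responses agree by rewriting.\<close>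
  show ?thesis by (simp add: pen_pls_t_eq_pls_t)
qed

end
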